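(* Let $(x^k)_{k\in\mathbb{N}}$ be the sequence generated by Method 2. The following statements hold: (i) If $S_*\neq\emptyset$, then $(x^k)_{k\in\mathbb{N}}$ is quasi-Fejér convergent to $S_*$ and weakly converges to a point in $S_*$. (ii) If $S_*=\emptyset$, then $\lim_{k\to\infty}\|x^k\|=+\infty$ and $\lim_{k\to\infty}(f+g)(x^k)=\inf_{x\in\mathcal{H}}(f+g)(x)$.
   Context: Let $\mathcal{H}$ be a real Hilbert space with inner product $\langle\cdot,\cdot\rangle$ and induced norm $\|\cdot\|$; $\overline{\mathbb{R}}:=\mathbb{R}\cup\{+\infty\}$ and $\operatorname{dom}h:=\{x\in\mathcal{H}: h(x)<+\infty\}$. Standing assumptions. (A1) $f,g:\mathcal{H}\to\overline{\mathbb{R}}$ are proper lower semicontinuous convex functions with $\operatorname{dom}g\subseteq\operatorname{dom}f$. (A2) $f$ is Fréchet differentiable on an open set containing $\operatorname{dom}g$; its gradient $\nabla f$ is uniformly continuous on any bounded subset of $\operatorname{dom}g$ and maps any bounded subset of $\operatorname{dom}g$ to a bounded set in $\mathcal{H}$. $S_*$ denotes the (possibly empty) set of minimizers of $f+g$ over $\mathcal{H}$. The proximal operator is $\operatorname{prox}_{g}:=(\mathrm{Id}+\partial g)^{-1}$, which is single-valued and defined on all of $\mathcal{H}$ with values in $\operatorname{dom}g$. A sequence $(x^k)_{k\in\mathbb{N}}$ in $\mathcal{H}$ is quasi-Fejér convergent to a nonempty set $S\subseteq\mathcal{H}$ if for every $x\in S$ there is a sequence $(\epsilon_k)_{k\in\mathbb{N}}$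 in $[0,\infty)$ with $\sum_{k=0}^\infty\epsilon_k<+\infty$ and $\|x^{k+1}-x\|^2\le\|x^k-x\|^2+\epsilon_k$ for all $k\in\mathbb{N}$. Linesearch 2 $(x,\theta)$, for $x\in\operatorname{dom}g$, $\theta\in(0,1)$: set $\beta=1$ and $J_x:=\operatorname{prox}_g(x-\nabla f(x))$; while $$(f+g)(x-\beta(x-J_x))>(f+g)(x)-\beta[g(x)-g(J_x)]-\beta\langle\nabla f(x),x-J_x\rangle+\tfrac{\beta}{2}\|x-J_x\|^2,$$ replace $\beta$ by $\theta\beta$; output $\beta$. Method 2: choose $x^0\in\operatorname{dom}g$ and $\theta\in(0,1)$. For $k=0,1,2,\dots$ set $J_k=\operatorname{prox}_g(x^k-\nabla f(x^k))$ and $x^{k+1}=x^k-\beta_k(x^k-J_k)$, where $\beta_k$ is the output of Linesearch 2 $(x^k,\theta)$; the stop criterion is $x^{k+1}=x^k$. The statement concerns the infinite sequence $(x^k)_{k\in\mathbb{N}}$ so generated. *)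

theory Defs
  imports "HOL-Analysis.Analysis" "HOL-Library.While_Combinator"
begin

text \<open>
  Functions with values in \<open>(-\<infinity>, +\<infinity>]\<close> are modelled as \<^typ>\<open>ereal\<close>-valued
  functions; the value \<open>-\<infinity>\<close> is excluded by properness. A real Hilbert space is a type of
  sort \<open>{real_inner, complete_space}\<close>.
\<close>

definition effdom :: "('a \<Rightarrow> ereal) \<Rightarrow> 'a set" where
  "effdom h = {x. h x < \<infinity>}"

definition proper :: "('a \<Rightarrow> ereal) \<Rightarrow> bool" where
  "proper h \<longleftrightarrow> (\<forall>x. h x \<noteq> -\<infinity>) \<and> effdom h \<noteq> {}"

definition lsc :: "('a::topological_space \<Rightarrow> ereal) \<Rightarrow> bool" where
  "lsc h \<longleftrightarrow> (\<forall>x. h x \<le> Liminf (at x) h)"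

definition convex_ereal :: "('a::real_vector \<Rightarrow> ereal) \<Rightarrow> bool" where
  "convex_ereal h \<longleftrightarrow> (\<forall>x y. \<forall>t::real. 0 < t \<and> t < 1 \<longrightarrow>
     h (t *\<^sub>R x + (1 - t) *\<^sub>R y) \<le> ereal t * h x + ereal (1 - t) * h y)"

text \<open>
  The real part \<open>real_of_ereal\<close> sends \<open>\<infinity>\<close> to \<open>0\<close>, so the next two notions are meaningful
  only at points of the interior of the effective domain; differentiability on \<open>U\<close> therefore
  includes \<open>U \<subseteq> effdom h\<close>. The library's \<open>differentiable\<close> is Frechet differentiability.
\<close>

definition frechet_differentiable_on_open ::
    "('a::real_normed_vector \<Rightarrow> ereal) \<Rightarrow> 'a set \<Rightarrow> bool" where
  "frechet_differentiable_on_open h U \<longleftrightarrow> open U \<and> U \<subseteq> effdom h \<and>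
     (\<forall>x\<in>U. (\<lambda>y. real_of_ereal (h y)) differentiable (at x))"

definition gradient :: "('a::real_inner \<Rightarrow> ereal) \<Rightarrow> 'a \<Rightarrow> 'a" where
  "gradient h x = (THE v. GDERIV (\<lambda>y. real_of_ereal (h y)) x :> v)"

definition minimizers :: "('a \<Rightarrow> ereal) \<Rightarrow> 'a set" where
  "minimizers h = {x. \<forall>y. h x \<le> h y}"

definition subdifferential :: "('a::real_inner \<Rightarrow> ereal) \<Rightarrow> 'a \<Rightarrow> 'a set" where
  "subdifferential h x = {v. \<forall>y. h x + ereal (v \<bullet> (y - x)) \<le> h y}"

text \<open>The unique value at \<open>z\<close> of the inverse of the set-valued operator \<open>Id + \<partial>h\<close>.\<close>

definition prox :: "('a::real_inner \<Rightarrow> ereal) \<Rightarrow> 'a \<Rightarrow> 'a" where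
  "prox h z = (THE p. \<exists>v\<in>subdifferential h p. z = p + v)"

definition quasi_fejer :: "(nat \<Rightarrow> 'a::real_normed_vector) \<Rightarrow> 'a set \<Rightarrow> bool" where
  "quasi_fejer x S \<longleftrightarrow> S \<noteq> {} \<and>
     (\<forall>s\<in>S. \<exists>\<epsilon>::nat \<Rightarrow> real. (\<forall>k. 0 \<le> \<epsilon> k) \<and> summable \<epsilon> \<and>
        (\<forall>k. (norm (x (Suc k) - s))\<^sup>2 \<le> (norm (x k - s))\<^sup>2 + \<epsilon> k))"

definition weakly_converges :: "(nat \<Rightarrow> 'a::real_inner) \<Rightarrow> 'a \<Rightarrow> bool" where
  "weakly_converges x l \<longleftrightarrow> (\<forall>y. (\<lambda>k. x k \<bullet> y) \<longlonglongrightarrow> l \<bullet> y)"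

definition fb_step ::
    "('a::real_inner \<Rightarrow> ereal) \<Rightarrow> ('a \<Rightarrow> ereal) \<Rightarrow> 'a \<Rightarrow> 'a" where
  "fb_step f g x = prox g (x - gradient f x)"

definition linesearch2 ::
    "('a::real_inner \<Rightarrow> ereal) \<Rightarrow> ('a \<Rightarrow> ereal) \<Rightarrow> 'a \<Rightarrow> real \<Rightarrow> real" where
  "linesearch2 f g x \<theta> = (let J = fb_step f g x in
     while
       (\<lambda>\<beta>. f (x - \<beta> *\<^sub>R (x - J)) + g (x - \<beta> *\<^sub>R (x - J)) >
             f x + g x - ereal \<beta> * (g x - g J)
             - ereal (\<beta> * (gradient f x \<bullet> (x - J)))
             + ereal (\<beta> / 2 * (norm (x - J))\<^sup>2))
       (\<lambda>\<beta>. \<theta> * \<beta>)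
       1)"

text \<open>
  The stop criterion \<open>x (Suc k) = x k\<close> is not encoded: the iteration is a function of the current
  point, so once it holds the sequence stays constant. The predicate thus holds of the
  infinite runs and of the constant continuations of the runs that stop.
\<close>

definition method2 ::
    "('a::real_inner \<Rightarrow> ereal) \<Rightarrow> ('a \<Rightarrow> ereal) \<Rightarrow> real \<Rightarrow> (nat \<Rightarrow> 'a) \<Rightarrow> bool" where
  "method2 f g \<theta> x \<longleftrightarrow> 0 < \<theta> \<and> \<theta> < 1 \<and> x 0 \<in> effdom g \<and>
     (\<forall>k. x (Suc k) = x k - linesearch2 f g (x k) \<theta> *\<^sub>R (x k - fb_step f g (x k)))"

end

(*
  Write Phi = f + g. Combining the linesearch inequality with the subgradient inequality for the
  prox and the gradient inequality for f gives, for every y in dom g and u = x k, v = x (k + 1),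
     |v - y|^2 + 2 Phi v + 2 beta (Phi u - Phi y) <= |u - y|^2 + 2 Phi u.
  If y is a minimizer this is quasi-Fejer monotonicity with errors 2 (Phi u - Phi v). If instead
  Phi (x k) does not tend to inf Phi, some y and c > 0 satisfy Phi y + c <= Phi (x k) for all k, so
  (x k) is bounded and the steps beta tend to 0; the rejected trial steps beta / theta together
  with uniform continuity of the gradient then force x k - J k -> 0 and
  limsup Phi (J k) <= Phi y for all y. In either case weak lower semicontinuity shows that weak
  cluster points of (x k) are minimizers. Opial's argument gives weak convergence when minimizers
  exist; when there are none, no subsequence can be bounded, and the values tend to the infimum.
*)

theory Submission
  imports Defs
begin

section \<open>Convex lower semicontinuous functions and proximal points\<close>

lemma convex_erealD:
  "convex_ereal h \<Longrightarrow> 0 < t \<Longrightarrow> t < 1 \<Longrightarrow>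
     h (t *\<^sub>R y + (1 - t) *\<^sub>R z) \<le> ereal t * h y + ereal (1 - t) * h z"
  by (simp add: convex_ereal_def)

lemma properD: "proper h \<Longrightarrow> h y \<noteq> -\<infinity>"
  by (simp add: proper_def)

lemma proper_effdom_real:
  assumes "proper h" "y \<in> effdom h"
  shows "h y = ereal (real_of_ereal (h y))"
  using assms by (cases "h y") (auto simp: proper_def effdom_def)

lemma mem_effdom: "h y \<le> ereal c \<Longrightarrow> y \<in> effdom h"
  by (auto simp: effdom_def)

lemma convex_ereal_real:
  assumes "proper h" "convex_ereal h" "y \<in> effdom h" "z \<in> effdom h" "0 \<le> t" "t \<le> 1"
  shows "t *\<^sub>R y + (1 - t) *\<^sub>R z \<in> effdom h"
    and "real_of_ereal (h (t *\<^sub>R y + (1 - t) *\<^sub>R z))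
           \<le> t * real_of_ereal (h y) + (1 - t) * real_of_ereal (h z)"
proof -
  have "h (t *\<^sub>R y + (1 - t) *\<^sub>R z)
      \<le> ereal (t * real_of_ereal (h y) + (1 - t) * real_of_ereal (h z))" (is "?l \<le> ?r")
  proof (cases "t = 0 \<or> t = 1")
    case True
    then show ?thesis
      using proper_effdom_real[OF assms(1,3)] proper_effdom_real[OF assms(1,4)]
      by (metis add_0 add.right_neutral diff_self diff_zero mult_1 mult_zero_left order_refl
          scaleR_one scaleR_zero_left)
  next
    case False
    with assms have "0 < t" "t < 1" by auto
    from convex_erealD[OF assms(2) this, of y z] show ?thesis
      by (subst (asm) proper_effdom_real[OF assms(1,3)],
          subst (asm) proper_effdom_real[OF assms(1,4)]) simp
  qed
  moreover from mem_effdom[of h, OF this] show "t *\<^sub>R y + (1 - t) *\<^sub>R z \<in> effdom h" .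
  ultimately show "real_of_ereal (h (t *\<^sub>R y + (1 - t) *\<^sub>R z))
           \<le> t * real_of_ereal (h y) + (1 - t) * real_of_ereal (h z)"
    using proper_effdom_real[OF assms(1)] by (metis ereal_less_eq(3))
qed

text \<open>\<open>lsc\<close> uses the punctured filter \<open>at x\<close>; the point
  \<open>x\<close> can be restored because \<open>a < h x\<close> holds there by assumption.\<close>

lemma lsc_iff_eventually_nhds:
  "lsc h \<longleftrightarrow> (\<forall>x a. a < h x \<longrightarrow> (\<forall>\<^sub>F y in nhds x. a < h y))"
  unfolding lsc_def le_Liminf_iff eventually_nhds_conv_at by blast

text \<open>Otherwise some \<open>a\<close> strictly between \<open>d\<close> and \<open>h l\<close>
  would eventually lie below \<open>h (y n)\<close> and above \<open>c n\<close>. The varying bound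
  serves minimizing sequences; a constant one gives closed sublevel sets.\<close>

lemma lsc_le_limit:
  fixes h :: "'a::topological_space \<Rightarrow> ereal"
  assumes "lsc h" "y \<longlonglongrightarrow> l" "c \<longlonglongrightarrow> d" "\<And>n. h (y n) \<le> c n"
  shows "h l \<le> d"
proof (rule ccontr)
  assume "\<not> h l \<le> d"
  then obtain a where a: "d < a" "a < h l" using dense by (metis not_le)
  have "\<forall>\<^sub>F n in sequentially. a < h (y n)"
    using assms(1,2) a(2) by (auto simp: lsc_iff_eventually_nhds intro: filterlim_iff[THEN iffD1, rule_format])
  moreover have "\<forall>\<^sub>F n in sequentially. c n < a"
    using assms(3) a(1) order_tendstoD(2) by blast
  ultimately have "\<forall>\<^sub>F n in sequentially. False"
    by eventually_elim (metis assms(4) leD order_less_le_trans order_less_trans)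
  then show False by simp
qed

lemma lsc_add:
  assumes "proper f" "proper g" "lsc f" "lsc g"
  shows "lsc (\<lambda>y. f y + g y)"
  unfolding lsc_iff_eventually_nhds
proof (intro allI impI)
  fix x a assume a: "a < f x + g x"
  have "f x \<noteq> -\<infinity>" "g x \<noteq> -\<infinity>" using assms(1,2) by (auto simp: proper_def)
  have "\<exists>b c. b < f x \<and> c < g x \<and> a \<le> b + c"
  proof -
    \<comment> \<open>Subtraction starts from a real \<open>s\<close>, since \<open>a\<close> may be
      -\<infinity> and the sum may be \<infinity>.\<close>
    obtain s where s: "a < ereal s" "ereal s < f x + g x" using ereal_dense2[OF a] by blast
    have "ereal s - f x < g x"
      using s(2) \<open>f x \<noteq> -\<infinity>\<close> \<open>g x \<noteq> -\<infinity>\<close> by (cases "f x"; cases "g x") auto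
    then obtain c where c: "ereal s - f x < ereal c" "ereal c < g x" using ereal_dense2 by blast
    have "ereal (s - c) < f x"
      using c(1) \<open>f x \<noteq> -\<infinity>\<close> by (cases "f x") auto
    with c(2) s(1) show ?thesis by (intro exI[of _ "ereal (s - c)"] exI[of _ "ereal c"]) auto
  qed
  then obtain b c where bc: "b < f x" "c < g x" "a \<le> b + c" by blast
  then have "\<forall>\<^sub>F y in nhds x. b < f y" "\<forall>\<^sub>F y in nhds x. c < g y"
    using assms(3,4) by (auto simp: lsc_iff_eventually_nhds)
  then show "\<forall>\<^sub>F y in nhds x. a < f y + g y"
    by eventually_elim (use bc(3) ereal_add_strict_mono2 order_le_less_trans in blast)
qed

lemma convex_ereal_add:
  assumes "proper f" "proper g" "convex_ereal f" "convex_ereal g"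
  shows "convex_ereal (\<lambda>y. f y + g y)"
  unfolding convex_ereal_def
proof (intro allI impI, elim conjE)
  fix y z and t :: real
  assume t: "0 < t" "t < 1"
  have nm: "f u \<noteq> -\<infinity>" "g u \<noteq> -\<infinity>" for u using assms(1,2) by (auto simp: proper_def)
  have "f (t *\<^sub>R y + (1 - t) *\<^sub>R z) + g (t *\<^sub>R y + (1 - t) *\<^sub>R z)
     \<le> (ereal t * f y + ereal (1 - t) * f z) + (ereal t * g y + ereal (1 - t) * g z)"
    by (intro add_mono convex_erealD assms t)
  also have "\<dots> = ereal t * (f y + g y) + ereal (1 - t) * (f z + g z)"
    using nm[of y] nm[of z] t
    by (cases "f y"; cases "g y"; cases "f z"; cases "g z") (auto simp: algebra_simps)
  finally show "f (t *\<^sub>R y + (1 - t) *\<^sub>R z) + g (t *\<^sub>R y + (1 - t) *\<^sub>R z)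
     \<le> ereal t * (f y + g y) + ereal (1 - t) * (f z + g z)" .
qed

text \<open>Lower semicontinuity bounds \<open>h\<close> below on a ball around a point of its
  domain; convexity along rays spreads the bound outwards with linear loss. A quadratic term
  dominates this cone.\<close>

lemma lsc_convex_minorant:
  fixes h :: "'a::real_normed_vector \<Rightarrow> ereal"
  assumes "proper h" "lsc h" "convex_ereal h"
  obtains a b :: real and y0 :: 'a where "b \<ge> 0" "\<And>y. h y \<ge> ereal (a - b * norm (y - y0))"
proof -
  obtain y0 where y0: "y0 \<in> effdom h" using assms(1) by (auto simp: proper_def)
  define c where "c = real_of_ereal (h y0)"
  have c: "h y0 = ereal c" unfolding c_def by (rule proper_effdom_real[OF assms(1) y0])
  have "\<forall>\<^sub>F y in nhds y0. ereal (c - 1) < h y"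
    using assms(2) c by (simp add: lsc_iff_eventually_nhds)
  then obtain d where d: "d > 0" "\<And>y. dist y y0 < d \<Longrightarrow> ereal (c - 1) < h y"
    unfolding eventually_nhds_metric by blast
  have "h y \<ge> ereal (c - 1 - 2 / d * norm (y - y0))" for y
  proof (cases "dist y y0 < d")
    case True
    have "ereal (c - 1 - 2 / d * norm (y - y0)) \<le> ereal (c - 1)" using d(1) by simp
    with d(2)[OF True] show ?thesis by (meson less_imp_le order_trans)
  next
    case False
    show ?thesis
    proof (cases "y \<in> effdom h")
      case True
      define n where "n = norm (y - y0)"
      \<comment> \<open>This \<open>t\<close> places \<open>u\<close> at distance
        \<open>d / 2\<close> from \<open>y0\<close>, inside the ball where \<open>h\<close> exceeds
        \<open>c - 1\<close>.\<close>
      define t where "t = d / (2 * n)"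
      have n: "n \<ge> d" using False by (simp add: n_def dist_norm)
      have t: "0 < t" "t < 1" using n d(1) by (auto simp: t_def)
      define u where "u = t *\<^sub>R y + (1 - t) *\<^sub>R y0"
      have "u - y0 = t *\<^sub>R (y - y0)" by (simp add: u_def algebra_simps)
      then have "dist u y0 = t * n" using t by (simp add: dist_norm n_def)
      also have "\<dots> < d" using n d(1) by (simp add: t_def)
      finally have "ereal (c - 1) < h u" by (rule d(2))
      moreover have "u \<in> effdom h" "real_of_ereal (h u) \<le> t * real_of_ereal (h y) + (1 - t) * c"
        using convex_ereal_real[OF assms(1,3) True y0, of t] t by (auto simp: u_def c_def)
      ultimately have "c - 1 < t * real_of_ereal (h y) + (1 - t) * c"
        using proper_effdom_real[OF assms(1)] by (metis ereal_less(2) less_ereal.simps(1) order_less_le_trans)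
      then have "t * (c - 1 / t) < t * real_of_ereal (h y)" using t by (simp add: algebra_simps)
      then have "c - 1 / t < real_of_ereal (h y)" using t by (simp add: mult_less_cancel_left)
      moreover have "1 / t = 2 / d * n" by (simp add: t_def)
      ultimately show ?thesis
        by (subst proper_effdom_real[OF assms(1) True]) (simp add: n_def)
    qed (auto simp: effdom_def)
  qed
  with d(1) show ?thesis by (intro that[of "2 / d" "c - 1" y0]) auto
qed

text \<open>The parallelogram law, with the weight left as \<open>1 - 1/2\<close> to match the
  instance \<open>t = 1/2\<close> of \<open>convex_ereal_real\<close>.\<close>

lemma midpoint_norm:
  fixes y y' z :: "'a::real_inner"
  shows "(norm ((1/2) *\<^sub>R y + (1 - 1/2) *\<^sub>R y' - z))\<^sup>2
      = ((norm (y - z))\<^sup>2 + (norm (y' - z))\<^sup>2) / 2 - (norm (y - y'))\<^sup>2 / 4"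
  by (simp add: power2_norm_eq_inner inner_diff inner_add inner_commute field_simps)

text \<open>By the midpoint identity a minimizing sequence of \<open>h + \<parallel>\<cdot> - z\<parallel>\<^sup>2 / 2\<close> is Cauchy.\<close>

lemma proximal_point_exists:
  fixes h :: "'a::{real_inner, complete_space} \<Rightarrow> ereal"
  assumes h: "proper h" "lsc h" "convex_ereal h"
  obtains p where "p \<in> effdom h" "z - p \<in> subdifferential h p"
proof -
  define D where "D = effdom h"
  define hr where "hr y = real_of_ereal (h y)" for y
  define \<phi> where "\<phi> y = hr y + (norm (y - z))\<^sup>2 / 2" for y
  have hr: "h y = ereal (hr y)" if "y \<in> D" for y
    using that proper_effdom_real[OF h(1)] by (simp add: D_def hr_def)
  have "D \<noteq> {}" using h(1) by (auto simp: proper_def D_def)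
  obtain a b y0 where ab: "b \<ge> 0" "\<And>y. h y \<ge> ereal (a - b * norm (y - y0))"
    using lsc_convex_minorant[OF h] by metis
  \<comment> \<open>The cone minorant falls at most linearly with slope \<open>b\<close>, so
    completing the square in \<open>norm (y - z)\<close> bounds \<open>\<phi>\<close> below.\<close>
  have "\<phi> y \<ge> a - b * norm (z - y0) - b\<^sup>2 / 2" if "y \<in> D" for y
  proof -
    have "hr y \<ge> a - b * norm (y - y0)" using ab(2)[of y] hr[OF that] by simp
    moreover have "b * norm (y - y0) \<le> b * (norm (y - z) + norm (z - y0))"
      using ab(1) by (intro mult_left_mono) (metis add_diff_eq diff_add_cancel norm_triangle_ineq)+
    moreover have "0 \<le> (norm (y - z) - b)\<^sup>2" by simp
    ultimately show ?thesis unfolding \<phi>_def by (simp add: power2_diff algebra_simps)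
  qed
  then have bdd: "bdd_below (\<phi> ` D)" by (auto intro!: bdd_belowI)
  define m where "m = Inf (\<phi> ` D)"
  have m: "m \<le> \<phi> y" if "y \<in> D" for y
    unfolding m_def using bdd that by (simp add: cInf_lower)
  have "\<exists>y\<in>D. \<phi> y < m + 1 / Suc n" for n
    using cInf_lessD[of "\<phi> ` D" "m + 1 / Suc n"] \<open>D \<noteq> {}\<close> by (auto simp: m_def)
  then obtain y where y: "\<And>n. y n \<in> D" "\<And>n. \<phi> (y n) < m + 1 / Suc n" by metis
  \<comment> \<open>The midpoint has value at least \<open>m\<close>, so the gain
    \<open>(norm (u - v))\<^sup>2 / 8\<close> in the midpoint identity is at most the mean excess of
    \<open>u\<close> and \<open>v\<close> over \<open>m\<close>.\<close>
  have mid: "(norm (u - v))\<^sup>2 \<le> 4 * (\<phi> u - m) + 4 * (\<phi> v - m)" if "u \<in> D" "v \<in> D" for u v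
  proof -
    let ?w = "(1/2) *\<^sub>R u + (1 - 1/2) *\<^sub>R v"
    have "?w \<in> D" "hr ?w \<le> 1/2 * hr u + (1 - 1/2) * hr v"
      using convex_ereal_real[OF h(1,3), of u v "1/2"] that by (auto simp: D_def hr_def)
    moreover from m[OF this(1)] have "m \<le> \<phi> ?w" .
    ultimately show ?thesis unfolding \<phi>_def midpoint_norm by argo
  qed
  have "Cauchy y"
  proof (rule metric_CauchyI)
    fix e :: real assume e: "e > 0"
    then obtain N where N: "1 / Suc N < e\<^sup>2 / 8" using nat_approx_posE[of "e\<^sup>2 / 8"] by auto
    have "dist (y i) (y j) < e" if "i \<ge> N" "j \<ge> N" for i j
    proof -
      have "1 / Suc i \<le> 1 / Suc N" "1 / Suc j \<le> 1 / Suc N" using that by (auto simp: frac_le)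
      then have "(dist (y i) (y j))\<^sup>2 < e\<^sup>2"
        using mid[OF y(1) y(1), of i j] y(2)[of i] y(2)[of j] N unfolding dist_norm by argo
      then show ?thesis using e by (simp add: power2_less_imp_less)
    qed
    then show "\<exists>N. \<forall>i\<ge>N. \<forall>j\<ge>N. dist (y i) (y j) < e" by blast
  qed
  then obtain p where p: "y \<longlonglongrightarrow> p" using Cauchy_convergent_iff convergent_def by blast
  have "h p \<le> ereal (m + 0 - (norm (p - z))\<^sup>2 / 2)"
  proof (rule lsc_le_limit[OF h(2) p])
    show "(\<lambda>n. ereal (m + 1 / Suc n - (norm (y n - z))\<^sup>2 / 2))
             \<longlonglongrightarrow> ereal (m + 0 - (norm (p - z))\<^sup>2 / 2)"
      by (intro tendsto_intros p LIMSEQ_Suc[OF lim_1_over_n]) simp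
    show "h (y n) \<le> ereal (m + 1 / Suc n - (norm (y n - z))\<^sup>2 / 2)" for n
      using y(2)[of n] by (simp add: hr[OF y(1)] \<phi>_def)
  qed
  then have pD: "p \<in> D" and pm: "\<phi> p \<le> m"
    using mem_effdom[of h p] hr[of p] by (auto simp: D_def \<phi>_def)
  \<comment> \<open>First-order optimality: \<open>p\<close> is compared with a point
    \<open>?w\<close> on the segment towards \<open>u\<close>; dividing by \<open>t\<close> and
    letting \<open>t\<close> tend to 0 removes the quadratic term.\<close>
  have "hr p + (z - p) \<bullet> (u - p) \<le> hr u" if u: "u \<in> D" for u
  proof -
    have "hr p - hr u + (z - p) \<bullet> (u - p) \<le> t * ((norm (u - p))\<^sup>2 / 2)" if t: "0 < t" "t < 1" for t
    proof -
      let ?w = "t *\<^sub>R u + (1 - t) *\<^sub>R p"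
      have w: "?w \<in> D" "hr ?w \<le> t * hr u + (1 - t) * hr p"
        using convex_ereal_real[OF h(1,3), of u p t] u pD t by (auto simp: D_def hr_def)
      have "?w - z = (p - z) + t *\<^sub>R (u - p)" by (simp add: algebra_simps)
      then have "(norm (?w - z))\<^sup>2 = (norm (p - z))\<^sup>2 - 2 * t * ((z - p) \<bullet> (u - p)) + t\<^sup>2 * (norm (u - p))\<^sup>2"
        unfolding power2_norm_eq_inner
        by (simp add: inner_diff inner_add algebra_simps inner_commute power2_eq_square)
      moreover have "\<phi> p \<le> \<phi> ?w" using pm m[OF w(1)] by linarith
      ultimately have "t * (hr p - hr u + (z - p) \<bullet> (u - p)) \<le> t * (t * ((norm (u - p))\<^sup>2 / 2))"
        using w(2) unfolding \<phi>_def by (simp add: algebra_simps power2_eq_square)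
      then show ?thesis using t by (simp add: mult_le_cancel_left)
    qed
    then have "\<forall>\<^sub>F t in at_right 0. hr p - hr u + (z - p) \<bullet> (u - p) \<le> t * ((norm (u - p))\<^sup>2 / 2)"
      by (auto simp: eventually_at_right[of 0 1] intro!: exI[of _ 1])
    moreover have "((\<lambda>t. t * ((norm (u - p))\<^sup>2 / 2)) \<longlongrightarrow> 0 * ((norm (u - p))\<^sup>2 / 2)) (at_right 0)"
      by (intro tendsto_intros)
    ultimately have "hr p - hr u + (z - p) \<bullet> (u - p) \<le> 0 * ((norm (u - p))\<^sup>2 / 2)"
      by (intro tendsto_lowerbound) auto
    then show ?thesis by simp
  qed
  then have "h p + ereal ((z - p) \<bullet> (u - p)) \<le> h u" for u
    using hr[OF pD] by (cases "u \<in> D") (auto simp: hr, auto simp: D_def effdom_def)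
  then show ?thesis using pD by (intro that[of p]) (auto simp: subdifferential_def D_def)
qed

section \<open>Monotonicity of the subdifferential and the proximal operator\<close>

text \<open>Adding the two subgradient inequalities cancels \<open>h p\<close> and
  \<open>h q\<close>. Both are finite: a subgradient excludes \<infinity> because \<open>h\<close>
  is finite somewhere, and properness excludes -\<infinity>.\<close>

lemma subdifferential_monotone:
  assumes h: "proper h" and u: "u \<in> subdifferential h p" and v: "v \<in> subdifferential h q"
  shows "(u - v) \<bullet> (p - q) \<ge> 0"
proof -
  have *: "h y \<noteq> \<infinity>" if "w \<in> subdifferential h y" for w y
  proof -
    obtain y0 where "h y0 < \<infinity>" using h by (auto simp: proper_def effdom_def)
    moreover have "h y + ereal (w \<bullet> (y0 - y)) \<le> h y0" using that by (simp add: subdifferential_def)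
    ultimately show ?thesis by auto
  qed
  have "h p + ereal (u \<bullet> (q - p)) \<le> h q" "h q + ereal (v \<bullet> (p - q)) \<le> h p"
    using u v by (auto simp: subdifferential_def)
  then have "u \<bullet> (q - p) + v \<bullet> (p - q) \<le> 0"
    using *[OF u] *[OF v] properD[OF h, of p] properD[OF h, of q]
    by (cases "h p"; cases "h q") auto
  then show ?thesis by (simp add: inner_diff algebra_simps)
qed

text \<open>Justifies the \<open>THE\<close> in \<open>prox\<close>: for two candidates,
  monotonicity makes minus their squared distance nonnegative.\<close>

lemma prox_eqI:
  assumes "proper h" "z - p \<in> subdifferential h p"
  shows "prox h z = p"
  unfolding prox_def
proof (rule the_equality)
  show "\<exists>v\<in>subdifferential h p. z = p + v"
    using assms(2) by (intro bexI[of _ "z - p"]) auto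
  fix q assume "\<exists>v\<in>subdifferential h q. z = q + v"
  then have "z - q \<in> subdifferential h q" by auto
  from subdifferential_monotone[OF assms(1) this assms(2)]
  have "- ((q - p) \<bullet> (q - p)) \<ge> 0" by (simp add: inner_diff algebra_simps)
  then have "(q - p) \<bullet> (q - p) = 0" using inner_ge_zero[of "q - p"] by linarith
  then show "q = p" by simp
qed

lemma
  fixes h :: "'a::{real_inner, complete_space} \<Rightarrow> ereal"
  assumes h: "proper h" "lsc h" "convex_ereal h"
  shows prox_in_effdom: "prox h z \<in> effdom h"
    and diff_prox_in_subdifferential: "z - prox h z \<in> subdifferential h (prox h z)"
  using proximal_point_exists[OF h, of z] prox_eqI[OF h(1)] by metis+

text \<open>Monotonicity yields firm nonexpansiveness,
  \<open>?d \<bullet> ?d \<le> (y - z) \<bullet> ?d\<close>; Cauchy-Schwarz does the rest.\<close>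

lemma prox_nonexpansive:
  fixes h :: "'a::{real_inner, complete_space} \<Rightarrow> ereal"
  assumes h: "proper h" "lsc h" "convex_ereal h"
  shows "norm (prox h y - prox h z) \<le> norm (y - z)"
proof -
  let ?d = "prox h y - prox h z"
  have "?d \<bullet> ?d \<le> (y - z) \<bullet> ?d"
    using subdifferential_monotone[OF h(1) diff_prox_in_subdifferential[OF h, of y]
        diff_prox_in_subdifferential[OF h, of z]]
    by (simp add: inner_diff algebra_simps)
  also have "\<dots> \<le> norm (y - z) * norm ?d" by (rule norm_cauchy_schwarz)
  finally have "norm ?d * norm ?d \<le> norm (y - z) * norm ?d"
    by (simp add: power2_norm_eq_inner[symmetric] power2_eq_square)
  then show ?thesis by (cases "?d = 0") (auto simp: mult_le_cancel_right)
qed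

section \<open>Projections and the Riesz representation\<close>

text \<open>The projection is the proximal point of the indicator function of \<open>C\<close>,
  whose subgradient inequality on \<open>C\<close> is the variational inequality.\<close>

lemma projection_exists:
  fixes C :: "'a::{real_inner, complete_space} set"
  assumes C: "closed C" "convex C" "C \<noteq> {}"
  obtains p where "p \<in> C" "\<And>y. y \<in> C \<Longrightarrow> (z - p) \<bullet> (y - p) \<le> 0"
proof -
  define h :: "'a \<Rightarrow> ereal" where "h y = (if y \<in> C then 0 else \<infinity>)" for y
  have eff: "effdom h = C" by (auto simp: h_def effdom_def)
  have "proper h" using C(3) by (auto simp: proper_def eff) (auto simp: h_def split: if_splits)
  moreover have "lsc h"
    unfolding lsc_iff_eventually_nhds
  proof (intro allI impI)
    fix x a assume a: "a < h x"
    show "\<forall>\<^sub>F y in nhds x. a < h y"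
    proof (cases "x \<in> C")
      case True
      with a show ?thesis by (auto simp: h_def intro!: always_eventually less_le_trans[of a 0])
    next
      case False
      then have "\<forall>\<^sub>F y in nhds x. y \<in> - C" using C(1) by (intro eventually_nhds_in_open) auto
      then show ?thesis by (rule eventually_mono) (use a False in \<open>auto simp: h_def\<close>)
    qed
  qed
  moreover have "convex_ereal h"
    unfolding convex_ereal_def
  proof (intro allI impI, elim conjE)
    fix y z and t :: real assume t: "0 < t" "t < 1"
    show "h (t *\<^sub>R y + (1 - t) *\<^sub>R z) \<le> ereal t * h y + ereal (1 - t) * h z"
      using t convexD[OF C(2), of y z t "1 - t"] by (auto simp: h_def)
  qed
  ultimately obtain p where p: "p \<in> effdom h" "z - p \<in> subdifferential h p"
    using proximal_point_exists[of h z] by metis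
  have "(z - p) \<bullet> (y - p) \<le> 0" if "y \<in> C" for y
  proof -
    have "h p + ereal ((z - p) \<bullet> (y - p)) \<le> h y" using p(2) by (simp add: subdifferential_def)
    then show ?thesis using p(1) that unfolding eff by (simp add: h_def)
  qed
  with p(1) show ?thesis using that unfolding eff by blast
qed

text \<open>A representing vector of \<open>D\<close> is the proximal point of \<open>-D\<close> at \<open>0\<close>.\<close>

lemma riesz_representation:
  fixes D :: "'a::{real_inner, complete_space} \<Rightarrow> real"
  assumes D: "bounded_linear D"
  obtains v where "D = (\<lambda>y. y \<bullet> v)"
proof -
  interpret bounded_linear D by (rule D)
  define h where "h y = ereal (- D y)" for y
  have "effdom h = UNIV" by (auto simp: effdom_def h_def)
  then have "proper h" by (auto simp: proper_def h_def)
  moreover have "lsc h"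
    unfolding lsc_iff_eventually_nhds
  proof (intro allI impI)
    fix y a assume "a < h y"
    moreover have "(h \<longlongrightarrow> h y) (nhds y)"
      unfolding h_def by (intro tendsto_intros tendsto) (rule filterlim_ident)
    ultimately show "\<forall>\<^sub>F u in nhds y. a < h u" by (simp add: order_tendstoD)
  qed
  moreover have "convex_ereal h"
    by (auto simp: convex_ereal_def h_def add scaleR)
  ultimately obtain p where "0 - p \<in> subdifferential h p"
    using proximal_point_exists[of h 0] by metis
  then have *: "- D p - p \<bullet> (y - p) \<le> - D y" for y
    unfolding subdifferential_def h_def by (auto dest: spec[of _ y])
  \<comment> \<open>Translating by \<open>p\<close> cancels \<open>D p\<close>; using the bound at
    \<open>- y\<close> too then gives equality.\<close>
  have le: "D y \<le> y \<bullet> p" for y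
    using *[of "y + p"] by (simp add: add inner_commute)
  have "D y = y \<bullet> p" for y
    using le[of y] le[of "- y"] unfolding neg inner_minus_left by linarith
  then show ?thesis by (intro that[of p]) auto
qed

section \<open>Weak convergence\<close>

text \<open>If \<open>p\<close> is the projection of \<open>l\<close> on \<open>C\<close>, the
  functional \<open>l - p\<close> separates \<open>l\<close> from \<open>C\<close>. Its values along
  \<open>u\<close> pass to the weak limit and give
  \<open>(l - p) \<bullet> (l - p) \<le> 0\<close>.\<close>

lemma weak_limit_in_closed_convex:
  fixes C :: "'a::{real_inner, complete_space} set"
  assumes C: "closed C" "convex C" and u: "weakly_converges u l" "\<forall>\<^sub>F k in sequentially. u k \<in> C"
  shows "l \<in> C"
proof -
  have "C \<noteq> {}" using u(2) eventually_happens'[OF sequentially_bot] by blast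
  then obtain p where p: "p \<in> C" "\<And>y. y \<in> C \<Longrightarrow> (l - p) \<bullet> (y - p) \<le> 0"
    using projection_exists[OF C, of l] by metis
  have "(\<lambda>k. u k \<bullet> (l - p) - p \<bullet> (l - p)) \<longlonglongrightarrow> l \<bullet> (l - p) - p \<bullet> (l - p)"
    using u(1) unfolding weakly_converges_def by (intro tendsto_diff tendsto_const) blast
  moreover have "\<forall>\<^sub>F k in sequentially. u k \<bullet> (l - p) - p \<bullet> (l - p) \<le> 0"
    using u(2) by eventually_elim (metis p(2) inner_diff_left inner_commute)
  ultimately have "l \<bullet> (l - p) - p \<bullet> (l - p) \<le> 0"
    by (intro tendsto_upperbound[of _ _ sequentially]) auto
  then have "(l - p) \<bullet> (l - p) = 0"
    using inner_ge_zero[of "l - p"] by (simp add: inner_diff_left)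
  with p(1) show ?thesis by simp
qed

text \<open>For each \<open>a\<close> above \<open>d\<close> the sublevel set is closed and convex,
  hence weakly sequentially closed, and it eventually contains \<open>u k\<close>.\<close>

lemma lsc_convex_le_weak_limit:
  fixes h :: "'a::{real_inner, complete_space} \<Rightarrow> ereal"
  assumes h: "lsc h" "convex_ereal h"
    and u: "weakly_converges u l" and c: "c \<longlonglongrightarrow> d" "\<And>k. h (u k) \<le> c k"
  shows "h l \<le> d"
proof (rule dense_ge)
  fix a assume a: "d < a"
  define C where "C = {y. h y \<le> a}"
  have "closed C"
    unfolding closed_sequential_limits C_def
    using lsc_le_limit[OF h(1) _ tendsto_const[of a]] by blast
  moreover have "convex C"
  proof (rule convexI)
    fix y z and t v :: real
    assume y: "y \<in> C" "z \<in> C" and t: "0 \<le> t" "0 \<le> v" "t + v = 1"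
    have v: "v = 1 - t" using t by simp
    show "t *\<^sub>R y + v *\<^sub>R z \<in> C"
    proof (cases "t = 0 \<or> t = 1")
      case False
      then have t: "0 < t" "t < 1" using t by auto
      have "h (t *\<^sub>R y + v *\<^sub>R z) \<le> ereal t * h y + ereal (1 - t) * h z"
        unfolding v by (rule convex_erealD[OF h(2) t])
      also have "\<dots> \<le> ereal t * a + ereal (1 - t) * a"
        using y t by (intro add_mono ereal_mult_left_mono) (auto simp: C_def)
      also have "\<dots> = a"
        using t by (cases a) (auto simp: algebra_simps)
      finally show ?thesis by (simp add: C_def)
    qed (use y v in auto)
  qed
  moreover have "\<forall>\<^sub>F k in sequentially. u k \<in> C"
    using order_tendstoD(2)[OF c(1) a] by eventually_elim (use c(2) in \<open>auto simp: C_def intro: order_trans less_imp_le\<close>)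
  ultimately have "l \<in> C" using weak_limit_in_closed_convex u by blast
  then show "h l \<le> a" by (simp add: C_def)
qed

section \<open>Weak sequential compactness\<close>

text \<open>Diagonal extraction in topological form: the rows \<open>a k\<close> lie in a countable
  product of compact intervals, which is compact and metrizable, hence sequentially compact.\<close>

lemma subsequence_with_convergent_coordinates:
  fixes a :: "nat \<Rightarrow> nat \<Rightarrow> real"
  assumes "\<And>k j. \<bar>a k j\<bar> \<le> M"
  obtains r :: "nat \<Rightarrow> nat" where "strict_mono r" "\<And>j. convergent (\<lambda>k. a (r k) j)"
proof -
  define K where "K = (UNIV :: nat set) \<rightarrow>\<^sub>E {-M..M}"
  have "compactin (product_topology (\<lambda>_::nat. euclideanreal) UNIV) K"
    unfolding K_def compactin_PiE by auto
  then have "compact K"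
    by (simp add: euclidean_product_topology)
  moreover have "a k \<in> K" for k using assms by (auto simp: K_def PiE_def abs_le_iff minus_le_iff)
  ultimately obtain l r where r: "strict_mono r" "(a \<circ> r) \<longlonglongrightarrow> l"
    unfolding compact_eq_seq_compact_metric seq_compact_def by blast
  have "(\<lambda>k. a (r k) j) \<longlonglongrightarrow> l j" for j
    using continuous_on_tendsto_compose[OF continuous_on_product_coordinates[of j] r(2)]
    by simp
  with r(1) show ?thesis by (intro that[of r]) (auto simp: convergent_def)
qed

text \<open>The extraction tests the sequence only against its own members, a countable family, so
  nonseparable spaces are covered.\<close>

lemma weakly_convergent_subsequence:
  fixes u :: "nat \<Rightarrow> 'a::{real_inner, complete_space}"
  assumes "bounded (range u)"
  obtains r l where "strict_mono r" "weakly_converges (u \<circ> r) l"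
proof -
  obtain M where M: "M > 0" "\<And>k. norm (u k) \<le> M" using assms by (auto simp: bounded_pos)
  have bd: "\<bar>u k \<bullet> y\<bar> \<le> M * norm y" for k y
    by (rule order_trans[OF Cauchy_Schwarz_ineq2]) (simp add: M(2) mult_right_mono)
  have "\<bar>u k \<bullet> u j\<bar> \<le> M * M" for k j
    using order_trans[OF bd[of k "u j"] mult_left_mono[OF M(2)[of j]]] M(1) by simp
  then obtain r :: "nat \<Rightarrow> nat" where r: "strict_mono r" "\<And>j. convergent (\<lambda>k. u (r k) \<bullet> u j)"
    using subsequence_with_convergent_coordinates[of "\<lambda>k j. u k \<bullet> u j"] by blast
  txt \<open>The subspace \<open>V\<close> is closed and contains every \<open>u j\<close>; vectors orthogonal to all \<open>u j\<close> lie in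
    it trivially, so \<open>V\<close> is the whole space and the weak limit is given by the Riesz theorem.\<close>
  define V where "V = {y. convergent (\<lambda>k. u (r k) \<bullet> y)}"
  have sub: "subspace V"
    unfolding subspace_def V_def
    by (auto simp: inner_add_right convergent_const intro: convergent_add convergent_mult)
  have "closed V"
    unfolding closed_sequential_limits
  proof (intro allI impI, elim conjE)
    fix y l assume y: "\<forall>n. y n \<in> V" "y \<longlonglongrightarrow> l"
    \<comment> \<open>Replacing \<open>l\<close> by \<open>y n\<close> costs an error uniform in
      \<open>k\<close>, because \<open>u\<close> is bounded.\<close>
    have "Cauchy (\<lambda>k. u (r k) \<bullet> l)"
    proof (rule metric_CauchyI)
      fix e :: real assume "e > 0"
      then have "e / (3 * M) > 0" using M(1) by simp
      with y(2) obtain n where n: "dist (y n) l < e / (3 * M)"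
        unfolding LIMSEQ_def by (meson order_refl)
      have near: "\<bar>u (r k) \<bullet> l - u (r k) \<bullet> y n\<bar> < e / 3" for k
      proof -
        have "\<bar>u (r k) \<bullet> (l - y n)\<bar> \<le> M * norm (l - y n)" by (rule bd)
        also have "\<dots> < M * (e / (3 * M))"
          using n M(1) by (intro mult_strict_left_mono) (auto simp: dist_norm norm_minus_commute)
        finally show ?thesis using M(1) by (simp add: inner_diff_right)
      qed
      have "Cauchy (\<lambda>k. u (r k) \<bullet> y n)" using y(1) by (auto simp: V_def intro: convergent_Cauchy)
      then obtain N where N: "\<And>i j. i \<ge> N \<Longrightarrow> j \<ge> N \<Longrightarrow> \<bar>u (r i) \<bullet> y n - u (r j) \<bullet> y n\<bar> < e / 3"
        using \<open>e > 0\<close> unfolding Cauchy_def dist_real_def by (metis zero_less_divide_iff zero_less_numeral)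
      have "dist (u (r i) \<bullet> l) (u (r j) \<bullet> l) < e" if "i \<ge> N" "j \<ge> N" for i j
        using near[of i] near[of j] N[OF that] unfolding dist_real_def by argo
      then show "\<exists>N. \<forall>i\<ge>N. \<forall>j\<ge>N. dist (u (r i) \<bullet> l) (u (r j) \<bullet> l) < e" by blast
    qed
    then show "l \<in> V" by (simp add: V_def Cauchy_convergent_iff)
  qed
  have all: "z \<in> V" for z
  proof -
    obtain p where p: "p \<in> V" "\<And>y. y \<in> V \<Longrightarrow> (z - p) \<bullet> (y - p) \<le> 0"
      using projection_exists[OF \<open>closed V\<close> subspace_imp_convex[OF sub], of z] subspace_0[OF sub] by blast
    \<comment> \<open>Since \<open>V\<close> is a subspace, the variational inequality applies to
      \<open>y + p\<close> and \<open>- y + p\<close>, which makes \<open>z - p\<close> orthogonal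
      to \<open>V\<close>.\<close>
    have le: "(z - p) \<bullet> y \<le> 0" if "y \<in> V" for y
      using p(2)[OF subspace_add[OF sub that p(1)]] by simp
    have "(z - p) \<bullet> y = 0" if "y \<in> V" for y
      using le[OF that] le[OF subspace_neg[OF sub that]] by simp
    then have orth: "y \<in> V \<Longrightarrow> y \<bullet> (z - p) = 0" for y by (simp add: inner_commute)
    moreover have "u j \<in> V" for j using r(2) by (simp add: V_def)
    ultimately have "(\<lambda>k. u (r k) \<bullet> (z - p)) = (\<lambda>_. 0)" by auto
    then have "z - p \<in> V" by (simp add: V_def convergent_const)
    from orth[OF this] p(1) show ?thesis by simp
  qed
  define L where "L y = lim (\<lambda>k. u (r k) \<bullet> y)" for y
  have L: "(\<lambda>k. u (r k) \<bullet> y) \<longlonglongrightarrow> L y" for y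
    using all by (simp add: V_def L_def convergent_LIMSEQ_iff)
  have "bounded_linear L"
  proof (rule bounded_linear_intro[of _ M])
    show "L (y + z) = L y + L z" for y z
      using LIMSEQ_unique[OF L] tendsto_add[OF L L] by (simp add: inner_add_right)
    show "L (c *\<^sub>R y) = c *\<^sub>R L y" for c y
      using LIMSEQ_unique[OF L] tendsto_mult_left[OF L] by simp
    show "norm (L y) \<le> norm y * M" for y
      using tendsto_upperbound[OF tendsto_rabs[OF L]] bd
      by (simp add: mult.commute)
  qed
  then obtain l where l: "L = (\<lambda>y. y \<bullet> l)" by (rule riesz_representation)
  have "weakly_converges (u \<circ> r) l"
    using L by (simp add: weakly_converges_def l inner_commute)
  with r(1) show ?thesis by (rule that)
qed

lemma frequently_subsequence:
  assumes "\<exists>\<^sub>F k in sequentially. P k"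
  obtains q :: "nat \<Rightarrow> nat" where "strict_mono q" "\<And>k. P (q k)"
proof -
  have "infinite {k. P k}"
    using assms by (simp add: cofinite_eq_sequentially[symmetric] frequently_cofinite)
  then show ?thesis using infinite_enumerate that by blast
qed

text \<open>Opial's argument: the difference of the two convergent sequences
  \<open>\<parallel>u k - l\<parallel>\<^sup>2\<close> and \<open>\<parallel>u k - l'\<parallel>\<^sup>2\<close> is affine in \<open>u k\<close>, so two weak cluster points \<open>l\<close>
  and \<open>l'\<close> in \<open>S\<close> coincide.\<close>

lemma opial:
  fixes u :: "nat \<Rightarrow> 'a::{real_inner, complete_space}"
  assumes bdd: "bounded (range u)"
    and conv: "\<And>s. s \<in> S \<Longrightarrow> convergent (\<lambda>k. (norm (u k - s))\<^sup>2)"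
    and clus: "\<And>r l. strict_mono r \<Longrightarrow> weakly_converges (u \<circ> r) l \<Longrightarrow> l \<in> S"
  shows "\<exists>s\<in>S. weakly_converges u s"
proof -
  obtain r l where r: "strict_mono r" "weakly_converges (u \<circ> r) l"
    using weakly_convergent_subsequence[OF bdd] .
  have lS: "l \<in> S" using clus r by blast
  have uniq: "l' = l" if q: "strict_mono q" "weakly_converges (u \<circ> q) l'" for q l'
  proof -
    have "l' \<in> S" using clus q by blast
    have eq: "u k \<bullet> (l - l') = ((norm (u k - l'))\<^sup>2 - (norm (u k - l))\<^sup>2 + (norm l)\<^sup>2 - (norm l')\<^sup>2) / 2" for k
      by (simp add: power2_norm_eq_inner inner_diff inner_commute field_simps)
    obtain a b where "(\<lambda>k. (norm (u k - l))\<^sup>2) \<longlonglongrightarrow> a" "(\<lambda>k. (norm (u k - l'))\<^sup>2) \<longlonglongrightarrow> b"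
      using conv[OF lS] conv[OF \<open>l' \<in> S\<close>] by (auto simp: convergent_def)
    then have lim: "(\<lambda>k. u k \<bullet> (l - l')) \<longlonglongrightarrow> (b - a + (norm l)\<^sup>2 - (norm l')\<^sup>2) / 2" (is "_ \<longlonglongrightarrow> ?c")
      unfolding eq by (intro tendsto_intros) auto
    have "l \<bullet> (l - l') = ?c"
      using LIMSEQ_unique LIMSEQ_subseq_LIMSEQ[OF lim r(1)] r(2)
      unfolding weakly_converges_def o_def by blast
    moreover have "l' \<bullet> (l - l') = ?c"
      using LIMSEQ_unique LIMSEQ_subseq_LIMSEQ[OF lim q(1)] q(2)
      unfolding weakly_converges_def o_def by blast
    ultimately have "(l - l') \<bullet> (l - l') = 0" by (simp add: inner_diff_left)
    then show ?thesis by simp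
  qed
  \<comment> \<open>If this failed, a subsequence would stay \<open>e\<close> away from
    \<open>l \<bullet> y\<close>; but a further subsequence converges weakly, to \<open>l\<close> by
    \<open>uniq\<close>.\<close>
  have "(\<lambda>k. u k \<bullet> y) \<longlonglongrightarrow> l \<bullet> y" for y
  proof (rule ccontr)
    assume "\<not> (\<lambda>k. u k \<bullet> y) \<longlonglongrightarrow> l \<bullet> y"
    then obtain e where e: "e > 0" "\<exists>\<^sub>F k in sequentially. \<not> dist (u k \<bullet> y) (l \<bullet> y) < e"
      unfolding tendsto_iff not_eventually by (auto simp: not_eventually)
    then obtain q :: "nat \<Rightarrow> nat" where q: "strict_mono q" "\<And>k. \<not> dist (u (q k) \<bullet> y) (l \<bullet> y) < e"
      using frequently_subsequence by blast
    have "bounded (range (u \<circ> q))" using bdd by (rule bounded_subset) auto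
    then obtain q' l' where q': "strict_mono q'" "weakly_converges (u \<circ> q \<circ> q') l'"
      by (rule weakly_convergent_subsequence)
    have "l' = l"
      using uniq[OF strict_mono_o[OF q(1) q'(1)]] q'(2) by (simp add: o_assoc)
    with q'(2) have "(\<lambda>k. u (q (q' k)) \<bullet> y) \<longlonglongrightarrow> l \<bullet> y" by (simp add: weakly_converges_def)
    then have "\<forall>\<^sub>F k in sequentially. dist (u (q (q' k)) \<bullet> y) (l \<bullet> y) < e"
      using e(1) tendstoD by blast
    then show False using q(2) by simp
  qed
  with lS show ?thesis by (auto simp: weakly_converges_def)
qed

section \<open>Gradients\<close>

lemma GDERIV_unique:
  assumes "GDERIV h x :> v" "GDERIV h x :> w"
  shows "v = w"
proof -
  have "(\<lambda>d. d \<bullet> v) = (\<lambda>d. d \<bullet> w)"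
    using assms unfolding gderiv_def by (rule has_derivative_unique)
  from fun_cong[OF this, of "v - w"] have "(v - w) \<bullet> (v - w) = 0" by (simp add: inner_diff_right)
  then show ?thesis by simp
qed

text \<open>Riesz turns the Frechet derivative into a vector, and uniqueness makes the
  \<open>THE\<close> in \<open>gradient\<close> denote it.\<close>

lemma GDERIV_gradient:
  fixes h :: "'a::{real_inner, complete_space} \<Rightarrow> ereal"
  assumes "frechet_differentiable_on_open h U" "x \<in> U"
  shows "GDERIV (\<lambda>y. real_of_ereal (h y)) x :> gradient h x"
proof -
  obtain D where D: "((\<lambda>y. real_of_ereal (h y)) has_derivative D) (at x)"
    using assms by (auto simp: frechet_differentiable_on_open_def differentiable_def)
  obtain v where "D = (\<lambda>y. y \<bullet> v)"
    using riesz_representation[OF has_derivative_bounded_linear[OF D]] .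
  with D have v: "GDERIV (\<lambda>y. real_of_ereal (h y)) x :> v" by (simp add: gderiv_def)
  show ?thesis unfolding gradient_def by (rule theI[where a = v]) (use v GDERIV_unique in blast)+
qed

lemma GDERIV_directional:
  assumes "GDERIV h x :> v"
  shows "((\<lambda>t. (h (x + t *\<^sub>R d) - h x) / t) \<longlongrightarrow> d \<bullet> v) (at_right 0)"
proof -
  have "((\<lambda>t::real. x + t *\<^sub>R d) has_derivative (\<lambda>t. t *\<^sub>R d)) (at 0)"
    by (auto intro!: derivative_eq_intros)
  moreover have "(h has_derivative (\<lambda>d. d \<bullet> v)) (at (x + 0 *\<^sub>R d))"
    using assms by (simp add: gderiv_def)
  ultimately have "((\<lambda>t. h (x + t *\<^sub>R d)) has_derivative (\<lambda>t. (t *\<^sub>R d) \<bullet> v)) (at 0)"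
    by (rule has_derivative_compose)
  then have "((\<lambda>t. h (x + t *\<^sub>R d)) has_field_derivative (d \<bullet> v)) (at 0)"
    by (simp add: has_field_derivative_def mult.commute[of _ "d \<bullet> v"])
  then show ?thesis
    unfolding DERIV_def by (auto intro: tendsto_mono at_le)
qed

text \<open>Convexity bounds the difference quotients from \<open>x\<close> towards \<open>y\<close>
  by the full increment; their one-sided limit is the directional derivative.\<close>

lemma convex_gradient_inequality:
  fixes h :: "'a::{real_inner, complete_space} \<Rightarrow> ereal"
  assumes h: "proper h" "convex_ereal h"
    and diff: "frechet_differentiable_on_open h U" "x \<in> U" and y: "y \<in> effdom h"
  shows "real_of_ereal (h x) + gradient h x \<bullet> (y - x) \<le> real_of_ereal (h y)"
proof -
  let ?r = "\<lambda>y. real_of_ereal (h y)"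
  have x: "x \<in> effdom h" using diff by (auto simp: frechet_differentiable_on_open_def)
  have "(?r (x + t *\<^sub>R (y - x)) - ?r x) / t \<le> ?r y - ?r x" if t: "0 < t" "t < 1" for t
  proof -
    have "x + t *\<^sub>R (y - x) = t *\<^sub>R y + (1 - t) *\<^sub>R x" by (simp add: algebra_simps)
    then have "?r (x + t *\<^sub>R (y - x)) \<le> t * ?r y + (1 - t) * ?r x"
      using convex_ereal_real(2)[OF h y x, of t] t by simp
    then show ?thesis using t by (simp add: field_simps)
  qed
  then have "\<forall>\<^sub>F t in at_right 0. (?r (x + t *\<^sub>R (y - x)) - ?r x) / t \<le> ?r y - ?r x"
    by (auto simp: eventually_at_right[of 0 1] intro!: exI[of _ 1])
  then have "(y - x) \<bullet> gradient h x \<le> ?r y - ?r x"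
    by (rule tendsto_upperbound[OF GDERIV_directional[OF GDERIV_gradient[OF diff]]]) simp
  then show ?thesis by (simp add: inner_commute)
qed

text \<open>With the number of passes explicit, termination of a loop reduces to exhibiting the
  first state that violates \<open>b\<close>.\<close>

lemma while_eq_funpow:
  assumes "\<not> b ((c ^^ n) s)" "\<And>m. m < n \<Longrightarrow> b ((c ^^ m) s)"
  shows "while b c s = (c ^^ n) s"
  using assms
proof (induction n arbitrary: s)
  case 0
  then show ?case by (subst while_unfold) simp
next
  case (Suc n)
  have "b s" using Suc.prems(2)[of 0] by simp
  moreover have "while b c (c s) = (c ^^ n) (c s)"
  proof (rule Suc.IH)
    show "\<not> b ((c ^^ n) (c s))" using Suc.prems(1) by (simp add: funpow_swap1)
    show "b ((c ^^ m) (c s))" if "m < n" for m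
      using Suc.prems(2)[of "Suc m"] that by (simp add: funpow_swap1)
  qed
  ultimately show ?case by (subst while_unfold) (simp add: funpow_swap1)
qed

section \<open>The forward-backward method with linesearch\<close>

locale forward_backward_linesearch =
  fixes f g :: "'a::{real_inner, complete_space} \<Rightarrow> ereal" and \<theta> :: real
  assumes f: "proper f" "lsc f" "convex_ereal f"
    and g: "proper g" "lsc g" "convex_ereal g"
    and dom: "effdom g \<subseteq> effdom f"
    and diff: "\<exists>U. effdom g \<subseteq> U \<and> frechet_differentiable_on_open f U"
    and grad: "\<And>B. bounded B \<Longrightarrow> B \<subseteq> effdom g \<Longrightarrow>
                 uniformly_continuous_on B (gradient f) \<and> bounded (gradient f ` B)"
    and \<theta>: "0 < \<theta>" "\<theta> < 1"
begin

abbreviation "D \<equiv> effdom g"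
abbreviation "F \<equiv> \<lambda>y. f y + g y"
abbreviation "G \<equiv> gradient f"
abbreviation "J \<equiv> fb_step f g"
abbreviation "step u \<equiv> linesearch2 f g u \<theta>"

text \<open>Real-valued copies, meaningful only on \<open>D\<close>, because
  \<open>real_of_ereal\<close> sends \<infinity> to 0.\<close>

definition fr :: "'a \<Rightarrow> real" where "fr y = real_of_ereal (f y)"
definition gr :: "'a \<Rightarrow> real" where "gr y = real_of_ereal (g y)"
definition \<Phi> :: "'a \<Rightarrow> real" where "\<Phi> y = fr y + gr y"

lemma f_eq: "y \<in> D \<Longrightarrow> f y = ereal (fr y)"
  using proper_effdom_real[OF f(1)] dom by (auto simp: fr_def)

lemma g_eq: "y \<in> D \<Longrightarrow> g y = ereal (gr y)"
  using proper_effdom_real[OF g(1)] by (auto simp: gr_def)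

lemma F_eq: "y \<in> D \<Longrightarrow> F y = ereal (\<Phi> y)"
  by (simp add: f_eq g_eq \<Phi>_def)

lemma F_outside: "y \<notin> D \<Longrightarrow> F y = \<infinity>"
  using properD[OF f(1), of y] by (simp add: effdom_def)

lemma J_in: "J u \<in> D"
  unfolding fb_step_def by (rule prox_in_effdom[OF g])

lemma gradient_inequality: "u \<in> D \<Longrightarrow> y \<in> D \<Longrightarrow> fr u + G u \<bullet> (y - u) \<le> fr y"
  using convex_gradient_inequality[OF f(1,3)] diff dom unfolding fr_def by blast

lemma prox_inequality:
  assumes "y \<in> D" shows "gr (J u) + (u - G u - J u) \<bullet> (y - J u) \<le> gr y"
  using diff_prox_in_subdifferential[OF g, of "u - G u"] g_eq[OF J_in] g_eq[OF assms]
  unfolding subdifferential_def fb_step_def[symmetric] by (auto dest: spec[of _ y])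

lemma
  assumes "u \<in> D" "y \<in> D" "0 \<le> t" "t \<le> 1"
  shows segment_in: "u - t *\<^sub>R (u - y) \<in> D"
    and segment_le: "gr (u - t *\<^sub>R (u - y)) \<le> gr u - t * (gr u - gr y)"
proof -
  have eq: "u - t *\<^sub>R (u - y) = t *\<^sub>R y + (1 - t) *\<^sub>R u" by (simp add: algebra_simps)
  show "u - t *\<^sub>R (u - y) \<in> D"
    unfolding eq using convex_ereal_real(1)[OF g(1,3)] assms by blast
  show "gr (u - t *\<^sub>R (u - y)) \<le> gr u - t * (gr u - gr y)"
    unfolding eq gr_def
    using convex_ereal_real(2)[OF g(1,3) assms(2,1,3,4)] by (simp add: algebra_simps)
qed

section \<open>Termination of the linesearch\<close>

text \<open>The loop guard of \<open>linesearch2\<close> in real arithmetic: the trial step is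
  rejected.\<close>

definition too_long :: "'a \<Rightarrow> real \<Rightarrow> bool" where
  "too_long u \<beta> \<longleftrightarrow> \<Phi> (u - \<beta> *\<^sub>R (u - J u)) >
     \<Phi> u - \<beta> * (gr u - gr (J u)) - \<beta> * (G u \<bullet> (u - J u)) + \<beta> / 2 * (norm (u - J u))\<^sup>2"

lemma too_long_iff:
  assumes "u \<in> D" "0 \<le> \<beta>" "\<beta> \<le> 1"
  shows "f (u - \<beta> *\<^sub>R (u - J u)) + g (u - \<beta> *\<^sub>R (u - J u)) >
           f u + g u - ereal \<beta> * (g u - g (J u)) - ereal (\<beta> * (G u \<bullet> (u - J u)))
             + ereal (\<beta> / 2 * (norm (u - J u))\<^sup>2) \<longleftrightarrow> too_long u \<beta>"
  using assms J_in segment_in[OF assms(1) J_in assms(2,3)]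
  by (simp add: f_eq g_eq \<Phi>_def too_long_def)

text \<open>The part of \<open>g\<close> is handled by convexity. For \<open>f\<close> the
  difference quotient tends to the directional derivative, and the term
  \<open>(norm (u - J u))\<^sup>2 / 2\<close> is a positive slack absorbing the error unless
  \<open>J u = u\<close>, where both sides agree.\<close>

lemma eventually_not_too_long:
  assumes u: "u \<in> D"
  shows "\<forall>\<^sub>F \<beta> in at_right 0. \<not> too_long u \<beta>"
proof (cases "J u = u")
  case False
  let ?d = "J u - u"
  obtain U where U: "frechet_differentiable_on_open f U" "u \<in> U" using diff u by blast
  have "((\<lambda>\<beta>. (fr (u + \<beta> *\<^sub>R ?d) - fr u) / \<beta>) \<longlongrightarrow> ?d \<bullet> G u) (at_right 0)"
    unfolding fr_def by (rule GDERIV_directional[OF GDERIV_gradient[OF U]])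
  moreover have "?d \<bullet> G u < ?d \<bullet> G u + (norm (u - J u))\<^sup>2 / 2" using False by simp
  ultimately have "\<forall>\<^sub>F \<beta> in at_right 0.
      (fr (u + \<beta> *\<^sub>R ?d) - fr u) / \<beta> < ?d \<bullet> G u + (norm (u - J u))\<^sup>2 / 2"
    by (rule order_tendstoD(2))
  moreover have "\<forall>\<^sub>F \<beta> in at_right 0. 0 < \<beta> \<and> \<beta> < (1::real)"
    by (auto simp: eventually_at_right[of 0 1] intro!: exI[of _ 1])
  ultimately show ?thesis
  proof eventually_elim
    case (elim \<beta>)
    have eq: "u + \<beta> *\<^sub>R ?d = u - \<beta> *\<^sub>R (u - J u)" by (simp add: algebra_simps)
    have d: "?d \<bullet> G u = - (G u \<bullet> (u - J u))" by (simp add: inner_diff inner_commute)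
    have "fr (u - \<beta> *\<^sub>R (u - J u)) - fr u < (- (G u \<bullet> (u - J u)) + (norm (u - J u))\<^sup>2 / 2) * \<beta>"
      using elim unfolding eq d by (simp only: pos_divide_less_eq)
    moreover have "gr (u - \<beta> *\<^sub>R (u - J u)) \<le> gr u - \<beta> * (gr u - gr (J u))"
      using segment_le[OF u J_in] elim by simp
    ultimately show ?case
      unfolding too_long_def \<Phi>_def not_less by (simp add: algebra_simps)
  qed
qed (simp add: too_long_def)

text \<open>An accepted power exists since \<open>\<theta> ^ m\<close> tends to 0 from the right;
  \<open>n\<close> is the least such exponent. Minimality records the rejected trials for
  \<open>rejected_trial_step\<close>.\<close>

lemma linesearch_spec:
  assumes u: "u \<in> D"
  obtains n where "step u = \<theta> ^ n" "\<not> too_long u (\<theta> ^ n)" "\<And>m. m < n \<Longrightarrow> too_long u (\<theta> ^ m)"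
proof -
  have pow: "((\<lambda>\<beta>. \<theta> * \<beta>) ^^ m) 1 = \<theta> ^ m" for m by (induction m) auto
  have "filterlim (\<lambda>m. \<theta> ^ m) (at_right 0) sequentially"
    using \<theta> by (auto simp: filterlim_at intro: LIMSEQ_realpow_zero)
  from eventually_compose_filterlim[OF eventually_not_too_long[OF u] this]
  obtain m where m: "\<not> too_long u (\<theta> ^ m)" using eventually_happens'[OF sequentially_bot] by blast
  define n where "n = (LEAST m. \<not> too_long u (\<theta> ^ m))"
  have n: "\<not> too_long u (\<theta> ^ n)" "\<And>m. m < n \<Longrightarrow> too_long u (\<theta> ^ m)"
    using LeastI[of "\<lambda>m. \<not> too_long u (\<theta> ^ m)", OF m] by (auto simp: n_def dest: not_less_Least)
  have "step u = ((\<lambda>\<beta>. \<theta> * \<beta>) ^^ n) 1"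
    unfolding linesearch2_def Let_def
    by (rule while_eq_funpow; subst too_long_iff) (use u n \<theta> in \<open>auto simp: pow power_le_one\<close>)
  then show ?thesis using that n by (simp add: pow)
qed

lemma step_bounds:
  assumes "u \<in> D" shows "0 < step u" "step u \<le> 1"
proof -
  obtain n where "step u = \<theta> ^ n" using linesearch_spec[OF assms] .
  with \<theta> show "0 < step u" "step u \<le> 1" by (simp_all add: power_le_one)
qed

section \<open>Estimates for a single step\<close>

definition next_point :: "'a \<Rightarrow> 'a" where
  "next_point u = u - step u *\<^sub>R (u - J u)"

lemma next_point_in: "u \<in> D \<Longrightarrow> next_point u \<in> D"
  unfolding next_point_def using segment_in[OF _ J_in] step_bounds[of u] by simp

lemma step_inequality:
  assumes "u \<in> D"
  shows "\<Phi> (next_point u) \<le> \<Phi> u - step u * (gr u - gr (J u))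
     - step u * (G u \<bullet> (u - J u)) + step u / 2 * (norm (u - J u))\<^sup>2"
  using linesearch_spec[OF assms] unfolding next_point_def too_long_def not_less by metis

text \<open>The prox inequality at \<open>u\<close> itself makes the predicted decrease at least
  \<open>step u * (norm (u - J u))\<^sup>2\<close>, and the linesearch gives back only half of
  that.\<close>

lemma next_point_descent:
  assumes u: "u \<in> D"
  shows "\<Phi> (next_point u) \<le> \<Phi> u"
proof -
  have "(norm (u - J u))\<^sup>2 \<le> gr u - gr (J u) + G u \<bullet> (u - J u)"
    using prox_inequality[OF u, of u] by (simp add: power2_norm_eq_inner inner_diff)
  then have "step u * (norm (u - J u))\<^sup>2 \<le> step u * (gr u - gr (J u) + G u \<bullet> (u - J u))"
    using step_bounds[OF u] by (intro mult_left_mono) auto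
  moreover have "0 \<le> step u * (norm (u - J u))\<^sup>2" using step_bounds[OF u] by simp
  ultimately show ?thesis using step_inequality[OF u] by (simp add: algebra_simps)
qed

text \<open>The sum of the prox inequality at \<open>J u\<close> and the gradient inequality at
  \<open>u\<close>, both tested with \<open>y\<close>.\<close>

lemma fb_step_inequality:
  assumes u: "u \<in> D" and y: "y \<in> D"
  shows "(u - J u) \<bullet> (u - y) \<ge> \<Phi> u - \<Phi> y - (gr u - gr (J u))
           - G u \<bullet> (u - J u) + (norm (u - J u))\<^sup>2"
  using prox_inequality[OF y, of u] gradient_inequality[OF u y]
  unfolding \<Phi>_def by (simp add: power2_norm_eq_inner inner_diff inner_commute algebra_simps)

text \<open>Expand the square, bound the cross term by \<open>fb_step_inequality\<close> and add
  twice the linesearch inequality. The residual terms left over have coefficient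
  \<open>?b * ?b - 2 * ?b + ?b\<close>, nonpositive as \<open>?b \<le> 1\<close>.\<close>

lemma next_point_fejer:
  assumes u: "u \<in> D" and y: "y \<in> D"
  shows "(norm (next_point u - y))\<^sup>2 + 2 * \<Phi> (next_point u) + 2 * step u * (\<Phi> u - \<Phi> y)
           \<le> (norm (u - y))\<^sup>2 + 2 * \<Phi> u"
proof -
  let ?b = "step u" and ?n = "(norm (u - J u))\<^sup>2"
  have b: "0 < ?b" "?b \<le> 1" using step_bounds[OF u] .
  have sq: "(norm (a - t *\<^sub>R d))\<^sup>2 = (norm a)\<^sup>2 - 2 * (t * (d \<bullet> a)) + t * t * (norm d)\<^sup>2" for a d :: 'a and t
    unfolding power2_norm_eq_inner by (simp add: inner_diff inner_commute algebra_simps)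
  have "next_point u - y = (u - y) - ?b *\<^sub>R (u - J u)" by (simp add: next_point_def)
  then have "(norm (next_point u - y))\<^sup>2
      = (norm (u - y))\<^sup>2 - 2 * (?b * ((u - J u) \<bullet> (u - y))) + ?b * ?b * ?n"
    by (simp only: sq)
  moreover have "?b * ((u - J u) \<bullet> (u - y)) \<ge> ?b * (\<Phi> u - \<Phi> y - (gr u - gr (J u))
           - G u \<bullet> (u - J u) + ?n)"
    using b fb_step_inequality[OF u y] by (intro mult_left_mono) auto
  moreover have "?b * ?b * ?n \<le> ?b * ?n"
    using b by (intro mult_right_mono) (auto simp: mult_le_cancel_left2)
  ultimately show ?thesis using step_inequality[OF u] by (simp add: algebra_simps)
qed

text \<open>The gradient inequality at \<open>J u\<close> replaces \<open>fr u\<close> by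
  \<open>fr (J u)\<close>. The bound tends to \<open>\<Phi> y\<close> when the residual vanishes
  along bounded data.\<close>

lemma fb_step_value:
  assumes u: "u \<in> D" and y: "y \<in> D"
  shows "\<Phi> (J u) \<le> \<Phi> y + norm (u - J u) * (norm (u - y) + norm (G u - G (J u)))"
proof -
  have "\<Phi> (J u) \<le> \<Phi> y + (u - J u) \<bullet> (u - y) + (u - J u) \<bullet> (G u - G (J u)) - (norm (u - J u))\<^sup>2"
    using fb_step_inequality[OF u y] gradient_inequality[OF J_in u, of u]
    unfolding \<Phi>_def by (simp add: inner_diff inner_commute algebra_simps)
  also have "\<dots> \<le> \<Phi> y + norm (u - J u) * norm (u - y) + norm (u - J u) * norm (G u - G (J u)) - 0"
    by (intro add_mono diff_mono norm_cauchy_schwarz) auto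
  finally show ?thesis by (simp add: algebra_simps)
qed

text \<open>The rejected trial step was \<open>step u / \<theta>\<close>; the minimum keeps the trial point in \<open>dom g\<close>
  also when \<open>step u = 1\<close>.\<close>

lemma rejected_trial_step:
  assumes u: "u \<in> D" and lt: "step u < 1"
  defines "w \<equiv> u - min 1 (step u / \<theta>) *\<^sub>R (u - J u)"
  shows "norm (u - J u) \<le> 2 * norm (G u - G w)"
proof -
  obtain n where n: "step u = \<theta> ^ n" "\<And>m. m < n \<Longrightarrow> too_long u (\<theta> ^ m)"
    using linesearch_spec[OF u] by metis
  \<comment> \<open>A step below 1 means at least one reduction; \<open>\<theta> ^ m\<close> is the
    last rejected trial, and being at most 1 it is the value of the minimum.\<close>
  with lt obtain m where m: "n = Suc m" by (cases n) auto
  define b where "b = \<theta> ^ m"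
  have b: "0 < b" "b \<le> 1" using \<theta> by (auto simp: b_def power_le_one)
  have w: "w = u - b *\<^sub>R (u - J u)" using n(1) m b \<theta> by (simp add: w_def b_def min_def)
  have wD: "w \<in> D" unfolding w using segment_in[OF u J_in] b by simp
  have "gr w \<le> gr u - b * (gr u - gr (J u))" unfolding w using segment_le[OF u J_in] b by simp
  moreover have "too_long u b" using n(2) m by (simp add: b_def)
  then have "\<Phi> w > \<Phi> u - b * (gr u - gr (J u)) - b * (G u \<bullet> (u - J u)) + b / 2 * (norm (u - J u))\<^sup>2"
    by (simp add: too_long_def w)
  \<comment> \<open>Convexity is used at \<open>w\<close>, to bound \<open>fr w\<close> from above;
    against the rejection inequality only the difference \<open>G u - G w\<close> survives.\<close>
  moreover have "fr w \<le> fr u - b * (G w \<bullet> (u - J u))"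
    using gradient_inequality[OF wD u] by (simp add: w)
  ultimately have "b * ((norm (u - J u))\<^sup>2 / 2) < b * ((G u - G w) \<bullet> (u - J u))"
    unfolding \<Phi>_def inner_diff_left by (simp add: algebra_simps)
  then have "(norm (u - J u))\<^sup>2 / 2 < (G u - G w) \<bullet> (u - J u)" using b by simp
  also have "\<dots> \<le> norm (G u - G w) * norm (u - J u)" by (rule norm_cauchy_schwarz)
  finally have "norm (u - J u) * norm (u - J u) \<le> (2 * norm (G u - G w)) * norm (u - J u)"
    by (simp add: power2_eq_square)
  then show ?thesis by (cases "u = J u") (auto simp: mult_le_cancel_right)
qed

text \<open>\<open>prox\<close> is nonexpansive and \<open>G\<close> is bounded on \<open>B\<close>,
  so \<open>J u\<close> stays within a fixed distance of \<open>prox g 0\<close>.\<close>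

lemma bounded_fb_steps:
  assumes "bounded B" "B \<subseteq> D"
  shows "bounded (J ` B)"
proof -
  obtain M where M: "\<And>u. u \<in> B \<Longrightarrow> norm u \<le> M" using assms(1) unfolding bounded_iff by blast
  have "bounded (G ` B)" using grad[OF assms] ..
  then obtain N where N: "\<And>u. u \<in> B \<Longrightarrow> norm (G u) \<le> N" unfolding bounded_iff by auto
  have "norm (J u) \<le> norm (prox g 0) + (M + N)" if "u \<in> B" for u
  proof -
    have "norm (J u) \<le> norm (prox g 0) + norm (J u - prox g 0)" by (metis add.commute diff_add_cancel norm_triangle_ineq)
    moreover have "norm (J u - prox g 0) \<le> norm (u - G u - 0)"
      unfolding fb_step_def by (rule prox_nonexpansive[OF g])
    moreover have "\<dots> \<le> norm u + norm (G u)" by (simp add: norm_triangle_ineq4)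
    ultimately show ?thesis using M[OF that] N[OF that] by linarith
  qed
  then show ?thesis unfolding bounded_iff by blast
qed

end

section \<open>The sequence of iterates\<close>

locale forward_backward_iteration = forward_backward_linesearch +
  fixes x :: "nat \<Rightarrow> 'a"
  assumes x0: "x 0 \<in> D" and x_Suc: "\<And>k. x (Suc k) = next_point (x k)"
begin

lemma x_in: "x k \<in> D"
  by (induction k) (auto simp: x0 x_Suc next_point_in)

lemma decseq_value: "decseq (\<lambda>k. \<Phi> (x k))"
  by (intro decseq_SucI) (simp add: x_Suc next_point_descent x_in)

text \<open>The rejected trial points \<open>w k\<close> approach \<open>x k\<close>, so uniform
  continuity makes the gradients approach each other, and \<open>rejected_trial_step\<close> bounds
  the residual by their distance.\<close>

lemma vanishing_steps_residual:
  assumes bdd: "bounded (range x)" and steps: "(\<lambda>k. step (x k)) \<longlonglongrightarrow> 0"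
  shows "(\<lambda>k. norm (x k - J (x k))) \<longlonglongrightarrow> 0"
proof -
  have "bounded (range (J \<circ> x))"
    using bounded_fb_steps[OF bdd] x_in by (auto simp: image_comp)
  with bdd obtain M N where MN: "\<And>k. norm (x k) \<le> M" "\<And>k. norm (J (x k)) \<le> N"
    unfolding bounded_iff by auto
  define w where "w k = x k - min 1 (step (x k) / \<theta>) *\<^sub>R (x k - J (x k))" for k
  have nn: "0 \<le> min 1 (step (x k) / \<theta>)" for k using step_bounds[OF x_in, of k] \<theta> by simp
  have res: "norm (x k - J (x k)) \<le> M + N" for k
    using norm_triangle_ineq4[of "x k" "J (x k)"] MN[of k] by linarith
  have dist: "dist (x k) (w k) = min 1 (step (x k) / \<theta>) * norm (x k - J (x k))" for k
    using nn[of k] by (simp add: w_def dist_norm)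
  have le: "dist (x k) (w k) \<le> min 1 (step (x k) / \<theta>) * (M + N)" for k
    unfolding dist using nn res by (intro mult_left_mono) auto
  \<comment> \<open>Both sequences must lie in one bounded subset of \<open>D\<close> for uniform
    continuity to compare them.\<close>
  let ?B = "range x \<union> range w"
  have "bounded (range w)"
  proof (rule boundedI, elim rangeE, simp)
    fix k
    have "min 1 (step (x k) / \<theta>) * (M + N) \<le> 1 * (M + N)"
      using order_trans[OF norm_ge_zero res] by (intro mult_right_mono) auto
    then have "norm (w k - x k) \<le> M + N"
      using le[of k] by (simp add: dist_norm norm_minus_commute)
    then show "norm (w k) \<le> M + (M + N)"
      using norm_triangle_sub[of "w k" "x k"] MN(1)[of k] by linarith
  qed
  with bdd have "bounded ?B" by simp
  moreover have "?B \<subseteq> D"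
    unfolding w_def using x_in segment_in[OF x_in J_in nn] by auto
  ultimately have uc: "uniformly_continuous_on ?B G" using grad by blast
  have "(\<lambda>k. dist (x k) (w k)) \<longlonglongrightarrow> 0"
  proof (rule tendsto_sandwich[OF _ _ tendsto_const])
    have "(\<lambda>k. min 1 (step (x k) / \<theta>) * (M + N)) \<longlonglongrightarrow> min 1 (0 / \<theta>) * (M + N)"
      using \<theta> by (intro tendsto_intros steps) auto
    then show "(\<lambda>k. min 1 (step (x k) / \<theta>) * (M + N)) \<longlonglongrightarrow> 0" by simp
  qed (use le in auto)
  with uc have "(\<lambda>k. dist (G (x k)) (G (w k))) \<longlonglongrightarrow> 0"
    unfolding uniformly_continuous_on_sequentially by blast
  then have lim: "(\<lambda>k. 2 * norm (G (x k) - G (w k))) \<longlonglongrightarrow> 0"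
    using tendsto_mult_right_zero[of _ _ 2] by (simp add: dist_norm)
  have "\<forall>\<^sub>F k in sequentially. step (x k) < 1" using order_tendstoD(2)[OF steps] by simp
  then have "\<forall>\<^sub>F k in sequentially. norm (x k - J (x k)) \<le> 2 * norm (G (x k) - G (w k))"
    by eventually_elim (use rejected_trial_step[OF x_in] in \<open>simp add: w_def\<close>)
  then show ?thesis by (intro tendsto_sandwich[OF _ _ tendsto_const lim]) auto
qed

text \<open>If the values stay above \<open>\<Phi> y + c\<close>, the Fejer inequality at \<open>y\<close> bounds the sequence and
  makes the step sizes summable.\<close>

lemma values_above_infimum:
  assumes "\<not> (\<lambda>k. F (x k)) \<longlonglongrightarrow> (INF y. F y)"
  shows "bounded (range x)" "(\<lambda>k. step (x k)) \<longlonglongrightarrow> 0"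
proof -
  \<comment> \<open>In the extended reals a decreasing sequence converges to its infimum, so failure
    means that this infimum exceeds that of \<open>F\<close>.\<close>
  have "decseq (\<lambda>k. F (x k))"
    using decseq_value unfolding decseq_def by (simp add: F_eq x_in)
  then have "(\<lambda>k. F (x k)) \<longlonglongrightarrow> (INF k. F (x k))" by (rule LIMSEQ_INF)
  with assms have "(INF y. F y) \<noteq> (INF k. F (x k))" by metis
  moreover have "(INF y. F y) \<le> (INF k. F (x k))" by (intro INF_greatest INF_lower) auto
  ultimately have "(INF y. F y) < (INF k. F (x k))" by simp
  then obtain y where y: "F y < (INF k. F (x k))" unfolding INF_less_iff by blast
  then obtain a where a: "F y < ereal a" "ereal a < (INF k. F (x k))" using ereal_dense2 by blast
  have yD: "y \<in> D" using F_outside[of y] a(1) by force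
  define c where "c = a - \<Phi> y"
  have c: "c > 0" using a(1) F_eq[OF yD] by (simp add: c_def)
  have gap: "c \<le> \<Phi> (x k) - \<Phi> y" for k
  proof -
    have "ereal a \<le> F (x k)" using a(2) by (meson INF_lower UNIV_I less_imp_le order_trans)
    then show ?thesis by (simp add: F_eq x_in c_def)
  qed
  \<comment> \<open>A Lyapunov function: each iteration lowers it by at least \<open>2 * c\<close>
    times the step, and \<open>2 * \<Phi> y\<close> bounds it below.\<close>
  define V where "V k = (norm (x k - y))\<^sup>2 + 2 * \<Phi> (x k)" for k
  have V: "V (Suc k) + 2 * c * step (x k) \<le> V k" for k
  proof -
    have "step (x k) * c \<le> step (x k) * (\<Phi> (x k) - \<Phi> y)"
      using gap[of k] step_bounds[OF x_in, of k] by (intro mult_left_mono) auto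
    then show ?thesis
      using next_point_fejer[OF x_in[of k] yD] unfolding V_def x_Suc by (simp add: algebra_simps)
  qed
  have sum: "V n + (\<Sum>k<n. 2 * c * step (x k)) \<le> V 0" for n
  proof (induction n)
    case (Suc n)
    then show ?case using V[of n] by simp
  qed simp
  have pos: "0 \<le> 2 * c * step (x k)" for k using c step_bounds[OF x_in, of k] by simp
  have V_ge: "(norm (x n - y))\<^sup>2 + 2 * \<Phi> y \<le> V n" for n
    using gap[of n] c by (simp add: V_def)
  have "summable (\<lambda>k. 2 * c * step (x k))"
  proof (rule summableI_nonneg_bounded[where x = "V 0 - 2 * \<Phi> y"])
    show "(\<Sum>k<n. 2 * c * step (x k)) \<le> V 0 - 2 * \<Phi> y" for n
      using sum[of n] V_ge[of n] zero_le_power2[of "norm (x n - y)"] by linarith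
  qed (rule pos)
  then show "(\<lambda>k. step (x k)) \<longlonglongrightarrow> 0"
    using c summable_LIMSEQ_zero summable_mult_D by fastforce
  have "norm (x n) \<le> norm y + sqrt (V 0 - 2 * \<Phi> y)" for n
  proof -
    have "(norm (x n - y))\<^sup>2 \<le> V 0 - 2 * \<Phi> y"
      using sum[of n] V_ge[of n] sum_nonneg[of "{..<n}" "\<lambda>k. 2 * c * step (x k)"] pos by force
    then have "norm (x n - y) \<le> sqrt (V 0 - 2 * \<Phi> y)" by (rule real_le_rsqrt)
    then show ?thesis using norm_triangle_sub[of "x n" y] by linarith
  qed
  then show "bounded (range x)" unfolding bounded_iff by blast
qed

text \<open>If the values reach the infimum, weak lower semicontinuity suffices. Otherwise the
  residual vanishes, so \<open>J (x (r k))\<close> has the same weak limit, and there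
  \<open>fb_step_value\<close> controls the values.\<close>

lemma weak_cluster_point_minimizer:
  assumes r: "strict_mono r" and l: "weakly_converges (x \<circ> r) l"
  shows "l \<in> minimizers F"
proof (cases "(\<lambda>k. F (x k)) \<longlonglongrightarrow> (INF y. F y)")
  case True
  have "F l \<le> (INF y. F y)"
    by (rule lsc_convex_le_weak_limit[OF lsc_add[OF f(1) g(1) f(2) g(2)]
          convex_ereal_add[OF f(1) g(1) f(3) g(3)] l LIMSEQ_subseq_LIMSEQ[OF True r]]) simp
  then show ?thesis by (auto simp: minimizers_def intro: order_trans INF_lower)
next
  case False
  note bdd = values_above_infimum(1)[OF False] and steps = values_above_infimum(2)[OF False]
  note res = vanishing_steps_residual[OF bdd steps]
  have weak: "weakly_converges (\<lambda>k. J (x (r k))) l"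
    unfolding weakly_converges_def
  proof
    fix y
    have "(\<lambda>k. x k - J (x k)) \<longlonglongrightarrow> 0" using res by (rule tendsto_norm_zero_cancel)
    from tendsto_inner[OF this tendsto_const[of y]]
    have "(\<lambda>k. (x k - J (x k)) \<bullet> y) \<longlonglongrightarrow> 0" by simp
    from LIMSEQ_subseq_LIMSEQ[OF this r]
    have "(\<lambda>k. x (r k) \<bullet> y - (x (r k) - J (x (r k))) \<bullet> y) \<longlonglongrightarrow> l \<bullet> y - 0"
      using l unfolding weakly_converges_def by (intro tendsto_diff) (auto simp: o_def)
    then show "(\<lambda>k. J (x (r k)) \<bullet> y) \<longlonglongrightarrow> l \<bullet> y" by (simp add: inner_diff_left)
  qed
  have "bounded (range (J \<circ> x))"
    using bounded_fb_steps[OF bdd] x_in by (auto simp: image_comp)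
  then have "bounded (G ` range (J \<circ> x))" "bounded (G ` range x)"
    using grad[of "range (J \<circ> x)"] grad[OF bdd] J_in x_in by auto
  with bdd obtain M N P where bds: "\<And>k. norm (x k) \<le> M" "\<And>k. norm (G (J (x k))) \<le> N" "\<And>k. norm (G (x k)) \<le> P"
    unfolding bounded_iff by auto
  have "F l \<le> F y" for y
  proof (cases "y \<in> D")
    case y: True
    \<comment> \<open>Bounds the second factor in \<open>fb_step_value\<close> uniformly in
      \<open>k\<close>.\<close>
    let ?C = "M + norm y + (P + N)"
    have "(\<lambda>k. \<Phi> y + norm (x k - J (x k)) * ?C) \<longlonglongrightarrow> \<Phi> y + 0 * ?C"
      by (intro tendsto_intros res)
    from LIMSEQ_subseq_LIMSEQ[OF this r]
    have "(\<lambda>k. ereal (\<Phi> y + norm (x (r k) - J (x (r k))) * ?C)) \<longlonglongrightarrow> ereal (\<Phi> y)"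
      by (simp add: o_def)
    moreover have "F (J (x (r k))) \<le> ereal (\<Phi> y + norm (x (r k) - J (x (r k))) * ?C)" for k
    proof -
      let ?u = "x (r k)"
      have "norm (?u - y) + norm (G ?u - G (J ?u)) \<le> ?C"
        using norm_triangle_ineq4[of ?u y] norm_triangle_ineq4[of "G ?u" "G (J ?u)"] bds[of "r k"]
        by linarith
      then have "norm (?u - J ?u) * (norm (?u - y) + norm (G ?u - G (J ?u))) \<le> norm (?u - J ?u) * ?C"
        by (rule mult_left_mono) simp
      with fb_step_value[OF x_in y, of "r k"] show ?thesis by (simp add: F_eq J_in)
    qed
    ultimately have "F l \<le> ereal (\<Phi> y)"
      by (rule lsc_convex_le_weak_limit[OF lsc_add[OF f(1) g(1) f(2) g(2)]
          convex_ereal_add[OF f(1) g(1) f(3) g(3)] weak])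
    then show ?thesis by (simp add: F_eq y)
  qed (simp add: F_outside)
  then show ?thesis by (simp add: minimizers_def)
qed

lemma minimizer_case:
  assumes ne: "minimizers F \<noteq> {}"
  shows "quasi_fejer x (minimizers F)"
    and "\<exists>s\<in>minimizers F. weakly_converges x s"
proof -
  have inD: "s \<in> D" and min: "\<Phi> s \<le> \<Phi> (x k)" if "s \<in> minimizers F" for s k
  proof -
    have le: "F s \<le> F (x k)" for k using that by (simp add: minimizers_def)
    show "s \<in> D" using F_outside[of s] le[of 0] F_eq[OF x_in, of 0] by force
    then show "\<Phi> s \<le> \<Phi> (x k)" using le[of k] by (simp add: F_eq x_in)
  qed
  obtain s0 where s0: "s0 \<in> minimizers F" using ne by blast
  have conv\<Phi>: "convergent (\<lambda>k. \<Phi> (x k))"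
    using decseq_convergent[OF decseq_value, of "\<Phi> s0"] min[OF s0] unfolding convergent_def by blast
  have dec: "(norm (x (Suc k) - s))\<^sup>2 + 2 * \<Phi> (x (Suc k)) \<le> (norm (x k - s))\<^sup>2 + 2 * \<Phi> (x k)"
    if s: "s \<in> minimizers F" for s k
  proof -
    have "0 \<le> 2 * step (x k) * (\<Phi> (x k) - \<Phi> s)"
      using min[OF s, of k] step_bounds[OF x_in, of k] by simp
    then show ?thesis using next_point_fejer[OF x_in inD[OF s], of k] by (simp add: x_Suc)
  qed
  \<comment> \<open>The Fejer errors telescope, and the values converge.\<close>
  have "summable (\<lambda>k. 2 * (\<Phi> (x k) - \<Phi> (x (Suc k))))"
    using conv\<Phi> telescope_summable' by (intro summable_mult) (auto simp: convergent_def)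
  moreover have "\<Phi> (x (Suc k)) \<le> \<Phi> (x k)" for k using decseq_SucD[OF decseq_value] .
  ultimately show "quasi_fejer x (minimizers F)"
    unfolding quasi_fejer_def using ne dec
    by (auto intro!: exI[of _ "\<lambda>k. 2 * (\<Phi> (x k) - \<Phi> (x (Suc k)))"] simp: algebra_simps)
  \<comment> \<open>The squared distance plus \<open>2 * \<Phi> (x k)\<close> decreases and is
    bounded below; subtracting the convergent values leaves the distance.\<close>
  have conv: "convergent (\<lambda>k. (norm (x k - s))\<^sup>2)" if s: "s \<in> minimizers F" for s
  proof -
    have V: "decseq (\<lambda>k. (norm (x k - s))\<^sup>2 + 2 * \<Phi> (x k))" using dec[OF s] by (rule decseq_SucI)
    moreover have "2 * \<Phi> s \<le> (norm (x k - s))\<^sup>2 + 2 * \<Phi> (x k)" for k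
      using min[OF s, of k] by (simp add: add_increasing)
    ultimately have "convergent (\<lambda>k. (norm (x k - s))\<^sup>2 + 2 * \<Phi> (x k))"
      using decseq_convergent[OF V, of "2 * \<Phi> s"] unfolding convergent_def by blast
    from convergent_diff[OF this convergent_mult[OF convergent_const[of 2] conv\<Phi>]] show ?thesis by simp
  qed
  from convergent_imp_Bseq[OF conv[OF s0]] obtain K where K: "\<And>k. (norm (x k - s0))\<^sup>2 \<le> K"
    unfolding Bseq_def by auto
  have "norm (x k) \<le> norm s0 + sqrt K" for k
    using real_le_rsqrt[OF K[of k]] norm_triangle_sub[of "x k" s0] by linarith
  then have "bounded (range x)" unfolding bounded_iff by blast
  then show "\<exists>s\<in>minimizers F. weakly_converges x s"
    by (rule opial) (use conv weak_cluster_point_minimizer in auto)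
qed

lemma no_minimizer_case:
  assumes empty: "minimizers F = {}"
  shows "filterlim (\<lambda>k. norm (x k)) at_top sequentially"
    and "(\<lambda>k. F (x k)) \<longlonglongrightarrow> (INF y. F y)"
proof -
  \<comment> \<open>A bounded subsequence would have a weak cluster point, hence a minimizer. The
    case \<open>q = id\<close> excludes the bounded situation of
    \<open>values_above_infimum\<close>.\<close>
  have no_bdd: "\<not> bounded (range (x \<circ> q))" if q: "strict_mono q" for q :: "nat \<Rightarrow> nat"
  proof
    assume "bounded (range (x \<circ> q))"
    then obtain r l where "strict_mono r" "weakly_converges (x \<circ> q \<circ> r) l"
      by (rule weakly_convergent_subsequence)
    then show False
      using weak_cluster_point_minimizer[OF strict_mono_o[OF q]] empty by (auto simp: o_assoc)
  qed
  show "(\<lambda>k. F (x k)) \<longlonglongrightarrow> (INF y. F y)"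
    using values_above_infimum(1) no_bdd[of id] strict_mono_id by auto
  show "filterlim (\<lambda>k. norm (x k)) at_top sequentially"
  proof (rule ccontr)
    assume "\<not> filterlim (\<lambda>k. norm (x k)) at_top sequentially"
    \<comment> \<open>Infinitely many iterates below a fixed norm form a bounded
      subsequence.\<close>
    then obtain Z where "\<exists>\<^sub>F k in sequentially. \<not> Z \<le> norm (x k)"
      unfolding filterlim_at_top by (auto simp: not_eventually)
    then obtain q :: "nat \<Rightarrow> nat" where q: "strict_mono q" "\<And>k. \<not> Z \<le> norm (x (q k))"
      using frequently_subsequence by blast
    then have "bounded (range (x \<circ> q))"
      unfolding bounded_iff by (auto intro!: exI[of _ Z] less_imp_le simp: not_le)
    with no_bdd q(1) show False by blast
  qed
qed

end

theorem theorem5p2: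
  fixes f g :: "'a::{real_inner, complete_space} \<Rightarrow> ereal"
    and \<theta> :: real
    and x :: "nat \<Rightarrow> 'a"
  assumes f: "proper f" "lsc f" "convex_ereal f"
    and g: "proper g" "lsc g" "convex_ereal g"
    and dom: "effdom g \<subseteq> effdom f"
    and diff: "\<exists>U. effdom g \<subseteq> U \<and> frechet_differentiable_on_open f U"
    and grad: "\<And>B. bounded B \<Longrightarrow> B \<subseteq> effdom g \<Longrightarrow>
                 uniformly_continuous_on B (gradient f) \<and> bounded (gradient f ` B)"
    and meth: "method2 f g \<theta> x"
  shows "(minimizers (\<lambda>y. f y + g y) \<noteq> {} \<longrightarrow>
            quasi_fejer x (minimizers (\<lambda>y. f y + g y)) \<and>
            (\<exists>s\<in>minimizers (\<lambda>y. f y + g y). weakly_converges x s))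
       \<and> (minimizers (\<lambda>y. f y + g y) = {} \<longrightarrow>
            filterlim (\<lambda>k. norm (x k)) at_top sequentially \<and>
            (\<lambda>k. f (x k) + g (x k)) \<longlonglongrightarrow> (INF y. f y + g y))"
proof -
  interpret forward_backward_linesearch f g \<theta>
    using f g dom diff grad meth by unfold_locales (auto simp: method2_def)
  interpret forward_backward_iteration f g \<theta> x
    using meth by unfold_locales (auto simp: method2_def next_point_def)
  show ?thesis using minimizer_case no_minimizer_case by blast
qed

end
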